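(* Let $\Psi\in\mathcal{H}=\mathbb{C}^N\otimes\mathbb{C}^N$ be a unit vector, let $f:\{a_1,\dots,a_N\}\to\mathbb{R}$ be a function, and let $\mathcal{E}_\Psi[f(A_1)|S]=e(S)$ be the quantum conditional expectation of $f(A_1)$ given $S$ in the state $\Psi$. Then for every eigenvalue $s_k$ of $S$ with $p(s_k)>0$, the value $\mathcal{E}_\Psi[f(A_1)|S=s_k]=e(s_k)$ is $$\mathcal{E}_\Psi[f(A_1)|S=s_k]=\sum_{(n,m):\,a_n+a_m=s_k}f(a_n)\,\frac{q_\Psi(a_n,s_k-a_n)}{p(s_k)}=\langle\Psi_{s_k},f(A_1)\Psi_{s_k}\rangle,$$ where $\Psi_{s_k}=\Pi_k\Psi/\sqrt{p(s_k)}$. That is, the expected value of $f(A_1)$ in the post-measurement state coincides with its quantum conditional expectation given $S$.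
   Context: $A$ is a Hermitian $N\times N$ matrix with $N$ distinct eigenvalues $a_1<\dots<a_N$ and corresponding orthonormal eigenvectors $|a_1\rangle,\dots,|a_N\rangle$ of $\mathbb{C}^N$. On $\mathcal{H}=\mathbb{C}^N\otimes\mathbb{C}^N$ put $A_1=A\otimes I$, $A_2=I\otimes A$, $S=A_1+A_2$, and $|a_n,a_m\rangle=|a_n\rangle\otimes|a_m\rangle$. The distinct eigenvalues of $S$ are $s_1<\dots<s_D$. $q_\Psi(a_n,a_m)=|\langle a_n,a_m|\Psi\rangle|^2$, $\Pi_k=\sum_{(n,m):\,a_n+a_m=s_k}|a_n,a_m\rangle\langle a_n,a_m|$ is the orthogonal projection onto the eigenspace of $S$ for $s_k$, and $p(s_k)=\sum_{(n,m):\,a_n+a_m=s_k}q_\Psi(a_n,a_m)$. Functions of $A_1$ and $S$ are defined by functional calculus. For an operator $O$ on $\mathcal{H}$, $\mathcal{E}_\Psi[O]=\operatorname{tr}(O|\Psi\rangle\langle\Psi|)=\langle\Psi,O\Psi\rangle$. Definition: the quantum conditional expectation of $f(A_1)$ given $S$ in the state $\Psi$, denoted $\mathcal{E}_\Psi[f(A_1)|S]$, is an operator of the form $e(S)$ with $e:\{s_1,\dots,s_D\}\to\mathbb{R}$ satisfying $$\mathcal{E}_\Psi\big[e(S)G(S)\big]=\mathcal{E}_\Psi\big[f(A_1)G(S)\big]\quad\text{for every function }G:\{s_1,\dots,s_D\}\to\mathbb{R}.$$ $\mathcal{E}_\Psi[f(A_1)|S=s_k]$ denotes the value $e(s_k)$.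 *)

theory Defs
  imports "HOL-Analysis.Analysis"
begin

(* Inner product in the physics convention: conjugate-linear in the first argument. *)
definition cinner :: "complex ^ 'm \<Rightarrow> complex ^ 'm \<Rightarrow> complex" where
  "cinner x y = (\<Sum>i\<in>UNIV. cnj (x $ i) * y $ i)"

definition hermitian :: "complex ^ 'm ^ 'm \<Rightarrow> bool" where
  "hermitian X \<longleftrightarrow> (\<forall>i j. X $ i $ j = cnj (X $ j $ i))"

(* The operator |x><y|. *)
definition ket_bra :: "complex ^ 'm \<Rightarrow> complex ^ 'm \<Rightarrow> complex ^ 'm ^ 'm" where
  "ket_bra x y = (\<chi> i j. x $ i * cnj (y $ j))"

(* The tensor product of C^n and C^n is identified with the complex vectors indexed by
   'n \<times> 'n, via the product basis. *)
definition tensor_vec :: "complex ^ 'n \<Rightarrow> complex ^ 'n \<Rightarrow> complex ^ ('n \<times> 'n)" where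
  "tensor_vec x y = (\<chi> i. x $ fst i * y $ snd i)"

definition tensor_mat ::
  "complex ^ 'n ^ 'n \<Rightarrow> complex ^ 'n ^ 'n \<Rightarrow> complex ^ ('n \<times> 'n) ^ ('n \<times> 'n)" where
  "tensor_mat X Y = (\<chi> i j. X $ fst i $ fst j * Y $ snd i $ snd j)"

definition op1 :: "complex ^ 'n ^ 'n \<Rightarrow> complex ^ ('n \<times> 'n) ^ ('n \<times> 'n)" where
  "op1 A = tensor_mat A (mat 1)"

definition op2 :: "complex ^ 'n ^ 'n \<Rightarrow> complex ^ ('n \<times> 'n) ^ ('n \<times> 'n)" where
  "op2 A = tensor_mat (mat 1) A"

definition op_sum :: "complex ^ 'n ^ 'n \<Rightarrow> complex ^ ('n \<times> 'n) ^ ('n \<times> 'n)" where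
  "op_sum A = op1 A + op2 A"

definition eigenspace :: "complex ^ 'm ^ 'm \<Rightarrow> real \<Rightarrow> (complex ^ 'm) set" where
  "eigenspace X l = {x. X *v x = complex_of_real l *s x}"

(* Only real eigenvalues are collected; a Hermitian matrix has no others. *)
definition eigenvalues :: "complex ^ 'm ^ 'm \<Rightarrow> real set" where
  "eigenvalues X = {l. \<exists>x. x \<noteq> 0 \<and> x \<in> eigenspace X l}"

(* Meaningful for a complex subspace V, where the matrix described exists and is unique. *)
definition orth_proj :: "(complex ^ 'm) set \<Rightarrow> complex ^ 'm ^ 'm" where
  "orth_proj V = (THE P. \<forall>x. P *v x \<in> V \<and> (\<forall>y\<in>V. cinner y (x - P *v x) = 0))"

(* Functional calculus g(X) of a Hermitian matrix X through its spectral decomposition;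
   only the values of g on the spectrum of X matter. *)
definition fun_calc :: "(real \<Rightarrow> real) \<Rightarrow> complex ^ 'm ^ 'm \<Rightarrow> complex ^ 'm ^ 'm" where
  "fun_calc g X = (\<Sum>l\<in>eigenvalues X. g l *\<^sub>R orth_proj (eigenspace X l))"

definition expect :: "complex ^ 'm \<Rightarrow> complex ^ 'm ^ 'm \<Rightarrow> complex" where
  "expect \<Psi> X = trace (X ** ket_bra \<Psi> \<Psi>)"

(* The operator e(S) is a quantum conditional expectation of the operator X given S
   in the state \<Psi>. *)
definition quantum_cond_exp ::
  "complex ^ 'm \<Rightarrow> complex ^ 'm ^ 'm \<Rightarrow> complex ^ 'm ^ 'm \<Rightarrow> (real \<Rightarrow> real) \<Rightarrow> bool" where
  "quantum_cond_exp \<Psi> X S e \<longleftrightarrow>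
     (\<forall>G :: real \<Rightarrow> real.
        expect \<Psi> (fun_calc e S ** fun_calc G S) = expect \<Psi> (X ** fun_calc G S))"

(* In what follows, ket x is the eigenvector |x> of A labelled by its eigenvalue x,
   and a 1, ..., a N are the eigenvalues of A. *)
definition index_pairs :: "nat \<Rightarrow> (nat \<Rightarrow> real) \<Rightarrow> real \<Rightarrow> (nat \<times> nat) set" where
  "index_pairs N a s = {(n, m). n \<in> {1..N} \<and> m \<in> {1..N} \<and> a n + a m = s}"

definition joint_prob ::
  "(real \<Rightarrow> complex ^ 'n) \<Rightarrow> complex ^ ('n \<times> 'n) \<Rightarrow> real \<Rightarrow> real \<Rightarrow> real" where
  "joint_prob ket \<Psi> x y = (cmod (cinner (tensor_vec (ket x) (ket y)) \<Psi>))\<^sup>2"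

definition sum_prob ::
  "nat \<Rightarrow> (nat \<Rightarrow> real) \<Rightarrow> (real \<Rightarrow> complex ^ 'n) \<Rightarrow> complex ^ ('n \<times> 'n) \<Rightarrow> real \<Rightarrow> real" where
  "sum_prob N a ket \<Psi> s = (\<Sum>(n, m)\<in>index_pairs N a s. joint_prob ket \<Psi> (a n) (a m))"

definition sum_proj ::
  "nat \<Rightarrow> (nat \<Rightarrow> real) \<Rightarrow> (real \<Rightarrow> complex ^ 'n) \<Rightarrow> real \<Rightarrow> complex ^ ('n \<times> 'n) ^ ('n \<times> 'n)" where
  "sum_proj N a ket s =
     (\<Sum>(n, m)\<in>index_pairs N a s.
        ket_bra (tensor_vec (ket (a n)) (ket (a m))) (tensor_vec (ket (a n)) (ket (a m))))"

definition post_state ::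
  "nat \<Rightarrow> (nat \<Rightarrow> real) \<Rightarrow> (real \<Rightarrow> complex ^ 'n) \<Rightarrow> complex ^ ('n \<times> 'n) \<Rightarrow> real
     \<Rightarrow> complex ^ ('n \<times> 'n)" where
  "post_state N a ket \<Psi> s = (1 / sqrt (sum_prob N a ket \<Psi> s)) *\<^sub>R (sum_proj N a ket s *v \<Psi>)"

end

(* In the product eigenbasis |a_n, a_m> the operators f(A_1), e(S) and G(S) are all diagonal, so
   their products and expectations reduce to sums weighted by q_Psi(a_n, a_m).  Testing the
   defining equation with G the indicator of s_k, for which G(S) is the projection Pi_k, gives
   e(s_k) p(s_k) = sum of f(a_n) q_Psi(a_n, a_m) over a_n + a_m = s_k.  The same sum, divided by
   p(s_k), is the expectation of f(A_1) in Pi_k Psi / sqrt (p(s_k)). *)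
theory Submission
  imports Defs
begin

section \<open>The Hermitian inner product and matrices acting on vectors\<close>

lemma cinner_add_right: "cinner x (y + z) = cinner x y + cinner x z"
  by (simp add: cinner_def ring_distribs sum.distrib)

lemma cinner_diff_right: "cinner x (y - z) = cinner x y - cinner x z"
  by (simp add: cinner_def ring_distribs sum_subtractf)

lemma cinner_scale_right: "cinner x (c *s y) = c * cinner x y"
  by (simp add: cinner_def sum_distrib_left mult_ac)

lemma cinner_scaleR_right: "cinner x (r *\<^sub>R y) = complex_of_real r * cinner x y"
  by (simp add: cinner_def sum_distrib_left scaleR_conv_of_real[where 'a = complex] mult_ac)

lemma cinner_zero_right [simp]: "cinner x 0 = 0"
  by (simp add: cinner_def)

lemma cinner_sum_right: "cinner x (\<Sum>i\<in>I. g i) = (\<Sum>i\<in>I. cinner x (g i))"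
  by (induction I rule: infinite_finite_induct) (auto simp: cinner_add_right)

lemma cinner_commute: "cinner y x = cnj (cinner x y)"
  by (simp add: cinner_def mult.commute)

text \<open>Positive definiteness is what later makes the orthogonal projection unique.\<close>

lemma cinner_self_eq_0_iff: "cinner x x = 0 \<longleftrightarrow> x = 0"
proof
  assume "cinner x x = 0"
  then have "complex_of_real (\<Sum>i\<in>UNIV. (cmod (x $ i))\<^sup>2) = 0"
    by (simp add: cinner_def complex_norm_square mult.commute del: of_real_power)
  then have "(\<Sum>i\<in>UNIV. (cmod (x $ i))\<^sup>2) = 0"
    by (simp only: of_real_eq_0_iff)
  then show "x = 0"
    by (simp add: sum_nonneg_eq_0_iff vec_eq_iff)
qed simp

lemma ket_bra_mult_vec: "ket_bra x y *v z = cinner y z *s x"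
  by (simp add: ket_bra_def cinner_def matrix_vector_mult_def vec_eq_iff sum_distrib_left
      sum_distrib_right mult_ac)

lemma sum_matrix_vector_mult:
  fixes M :: "'i \<Rightarrow> complex ^ 'm ^ 'k"
  shows "(\<Sum>i\<in>I. M i) *v x = (\<Sum>i\<in>I. M i *v x)"
  by (induction I rule: infinite_finite_induct) (auto simp: matrix_vector_mult_add_rdistrib)

lemma scaleR_matrix_vector_mult:
  fixes M :: "complex ^ 'm ^ 'k"
  shows "(r *\<^sub>R M) *v x = complex_of_real r *s (M *v x)"
  by (simp add: matrix_vector_mult_def vec_eq_iff sum_distrib_left scaleR_conv_of_real[where 'a = complex] mult_ac)

lemma expect_eq_cinner: "expect x X = cinner x (X *v x)"
proof -
  have "expect x X = (\<Sum>i\<in>UNIV. \<Sum>j\<in>UNIV. X $ i $ j * (x $ j * cnj (x $ i)))"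
    by (simp add: expect_def trace_def matrix_matrix_mult_def ket_bra_def)
  also have "\<dots> = cinner x (X *v x)"
    by (simp add: cinner_def matrix_vector_mult_def sum_distrib_left mult_ac)
  finally show ?thesis .
qed

section \<open>Product vectors in the tensor product\<close>

lemma tensor_mat_mult_tensor_vec:
  "tensor_mat X Y *v tensor_vec x y = tensor_vec (X *v x) (Y *v y)"
proof -
  have "(tensor_mat X Y *v tensor_vec x y) $ i = tensor_vec (X *v x) (Y *v y) $ i" for i
  proof -
    \<comment> \<open>Keeping the index set visibly a product, here and under
      \<open>del: UNIV_Times_UNIV\<close>, lets the sum over pairs factor into a product of two
      sums.\<close>
    have "(tensor_mat X Y *v tensor_vec x y) $ i =
        (\<Sum>j\<in>UNIV \<times> UNIV. (X $ fst i $ fst j * x $ fst j) * (Y $ snd i $ snd j * y $ snd j))"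
      by (simp add: tensor_mat_def tensor_vec_def matrix_vector_mult_def mult_ac)
    also have "\<dots> = tensor_vec (X *v x) (Y *v y) $ i"
      by (simp add: tensor_vec_def matrix_vector_mult_def sum_product sum.cartesian_product
          split_def del: UNIV_Times_UNIV)
    finally show ?thesis .
  qed
  then show ?thesis
    by (simp add: vec_eq_iff)
qed

lemma cinner_tensor_vec:
  "cinner (tensor_vec x y) (tensor_vec x' y') = cinner x x' * cinner y y'"
proof -
  have "cinner (tensor_vec x y) (tensor_vec x' y') =
      (\<Sum>j\<in>UNIV \<times> UNIV. (cnj (x $ fst j) * x' $ fst j) * (cnj (y $ snd j) * y' $ snd j))"
    by (simp add: tensor_vec_def cinner_def mult_ac)
  also have "\<dots> = cinner x x' * cinner y y'"
    by (simp add: cinner_def sum_product sum.cartesian_product split_def del: UNIV_Times_UNIV)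
  finally show ?thesis .
qed

lemma tensor_vec_scale_left: "tensor_vec (c *s x) y = c *s tensor_vec x y"
  by (simp add: tensor_vec_def vec_eq_iff mult_ac)

lemma tensor_vec_scale_right: "tensor_vec x (c *s y) = c *s tensor_vec x y"
  by (simp add: tensor_vec_def vec_eq_iff mult_ac)

section \<open>Orthonormal bases and operators diagonal in them\<close>

definition diag_op :: "('i \<Rightarrow> complex ^ 'm) \<Rightarrow> 'i set \<Rightarrow> ('i \<Rightarrow> real) \<Rightarrow> complex ^ 'm ^ 'm" where
  "diag_op b I c = (\<Sum>i\<in>I. c i *\<^sub>R ket_bra (b i) (b i))"

text \<open>The cardinality condition stands in for spanning, which \<open>completeness\<close>
  derives. The index type is arbitrary so that pairs (n, m) can label the product basis.\<close>

locale orthonormal_basis =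
  fixes b :: "'i \<Rightarrow> complex ^ 'm" and I :: "'i set"
  assumes finite_index: "finite I"
    and card_index: "card I = CARD('m)"
    and orthonormal: "\<And>i j. i \<in> I \<Longrightarrow> j \<in> I \<Longrightarrow> cinner (b i) (b j) = (if i = j then 1 else 0)"
begin

text \<open>With the basis vectors as columns of a square matrix \<open>B\<close>, orthonormality
  makes the adjoint \<open>B'\<close> a left inverse. For square matrices it is then also a right
  inverse, and \<open>B ** B'\<close> is the sum of the rank-one projections.\<close>

lemma completeness: "(\<Sum>i\<in>I. ket_bra (b i) (b i)) = mat 1"
proof -
  \<comment> \<open>Relabelling the basis by \<open>'m\<close> makes \<open>B\<close>
    square.\<close>
  obtain h where h: "bij_betw h (UNIV :: 'm set) I"
    using finite_same_card_bij[of "UNIV :: 'm set" I] finite_index card_index by auto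
  define B :: "complex ^ 'm ^ 'm" where "B = (\<chi> i j. b (h j) $ i)"
  define B' :: "complex ^ 'm ^ 'm" where "B' = (\<chi> i j. cnj (b (h i) $ j))"
  have h_eq: "h i = h j \<longleftrightarrow> i = j" and h_in: "h i \<in> I" for i j
    using h by (auto simp: bij_betw_def inj_on_def)
  have "(B' ** B) $ i $ j = cinner (b (h i)) (b (h j))" for i j
    by (simp add: B_def B'_def matrix_matrix_mult_def cinner_def)
  then have "B' ** B = mat 1"
    by (simp add: vec_eq_iff mat_def orthonormal h_in h_eq)
  then have BB': "B ** B' = mat 1"
    using matrix_left_right_inverse by blast
  have "(\<Sum>i\<in>I. ket_bra (b i) (b i)) = (\<Sum>j\<in>UNIV. ket_bra (b (h j)) (b (h j)))"
    by (rule sum.reindex_bij_betw[OF h, symmetric])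
  also have "\<dots> = B ** B'"
    by (simp add: vec_eq_iff B_def B'_def matrix_matrix_mult_def ket_bra_def)
  finally show ?thesis
    using BB' by simp
qed

lemma expansion: "x = (\<Sum>i\<in>I. cinner (b i) x *s b i)"
proof -
  have "x = (\<Sum>i\<in>I. ket_bra (b i) (b i)) *v x"
    by (simp add: completeness)
  then show ?thesis
    by (simp add: sum_matrix_vector_mult ket_bra_mult_vec)
qed

lemma vec_eqI:
  assumes "\<And>i. i \<in> I \<Longrightarrow> cinner (b i) x = cinner (b i) y"
  shows "x = y"
proof -
  have "(\<Sum>i\<in>I. cinner (b i) x *s b i) = (\<Sum>i\<in>I. cinner (b i) y *s b i)"
    using assms by (intro sum.cong) auto
  then show ?thesis
    using expansion[of x] expansion[of y] by simp
qed

lemma parseval: "cinner x y = (\<Sum>i\<in>I. cnj (cinner (b i) x) * cinner (b i) y)"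
proof -
  have "cinner x y = cinner x (\<Sum>i\<in>I. cinner (b i) y *s b i)"
    using expansion[of y] by simp
  also have "\<dots> = (\<Sum>i\<in>I. cinner (b i) y * cinner x (b i))"
    by (simp add: cinner_sum_right cinner_scale_right)
  also have "\<dots> = (\<Sum>i\<in>I. cnj (cinner (b i) x) * cinner (b i) y)"
    by (intro sum.cong refl) (simp add: cinner_commute[of x] mult.commute)
  finally show ?thesis .
qed

text \<open>This coordinate rule, combined with \<open>vec_eqI\<close> and \<open>parseval\<close>,
  reduces products and expectations of diagonal operators to scalar computations.\<close>

lemma cinner_basis_diag_op:
  assumes "i \<in> I"
  shows "cinner (b i) (diag_op b I c *v x) = c i * cinner (b i) x"
proof -
  have "cinner (b i) (diag_op b I c *v x) =
      (\<Sum>j\<in>I. c j * (cinner (b j) x * cinner (b i) (b j)))"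
    by (simp add: diag_op_def sum_matrix_vector_mult scaleR_matrix_vector_mult ket_bra_mult_vec
        cinner_sum_right cinner_scale_right mult.assoc)
  also have "\<dots> = (\<Sum>j\<in>I. if i = j then c j * cinner (b j) x else 0)"
    using assms by (intro sum.cong) (auto simp: orthonormal)
  also have "\<dots> = c i * cinner (b i) x"
    using assms finite_index by simp
  finally show ?thesis .
qed

lemma diag_op_mult: "diag_op b I c ** diag_op b I d = diag_op b I (\<lambda>i. c i * d i)"
proof -
  have "(diag_op b I c ** diag_op b I d) *v x = diag_op b I (\<lambda>i. c i * d i) *v x" for x
    unfolding matrix_vector_mul_assoc[symmetric]
    by (rule vec_eqI) (simp add: cinner_basis_diag_op)
  then show ?thesis
    by (simp add: matrix_eq)
qed

lemma expect_diag_op: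
  "expect x (diag_op b I c) = of_real (\<Sum>i\<in>I. c i * (cmod (cinner (b i) x))\<^sup>2)"
proof -
  have "expect x (diag_op b I c) =
      (\<Sum>i\<in>I. cnj (cinner (b i) x) * (c i * cinner (b i) x))"
    by (simp add: expect_eq_cinner parseval[of x] cinner_basis_diag_op)
  also have "\<dots> = of_real (\<Sum>i\<in>I. c i * (cmod (cinner (b i) x))\<^sup>2)"
    by (simp add: complex_norm_square mult_ac del: of_real_power)
  finally show ?thesis .
qed

end

section \<open>Spectral theory of an operator with a known orthonormal eigenbasis\<close>

locale eigenbasis = orthonormal_basis b I
  for b :: "'i \<Rightarrow> complex ^ 'm" and I +
  fixes X :: "complex ^ 'm ^ 'm" and ev :: "'i \<Rightarrow> real"
  assumes eigenvector: "\<And>i. i \<in> I \<Longrightarrow> X *v b i = complex_of_real (ev i) *s b i"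
begin

lemma cinner_basis_mult:
  assumes "i \<in> I"
  shows "cinner (b i) (X *v x) = ev i * cinner (b i) x"
proof -
  have "X *v x = X *v (\<Sum>j\<in>I. cinner (b j) x *s b j)"
    using expansion[of x] by simp
  also have "\<dots> = (\<Sum>j\<in>I. cinner (b j) x *s (X *v b j))"
    by (simp add: matrix_vector_mult_scaleR vector_scalar_commute
        linear_sum[OF matrix_vector_mul_linear])
  also have "\<dots> = (\<Sum>j\<in>I. cinner (b j) x *s (complex_of_real (ev j) *s b j))"
    by (intro sum.cong) (simp_all add: eigenvector)
  finally have "cinner (b i) (X *v x) =
      (\<Sum>j\<in>I. cinner (b j) x * (ev j * cinner (b i) (b j)))"
    by (simp add: cinner_sum_right cinner_scale_right mult.assoc)
  also have "\<dots> = (\<Sum>j\<in>I. if i = j then ev j * cinner (b j) x else 0)"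
    using assms by (intro sum.cong) (auto simp: orthonormal)
  also have "\<dots> = ev i * cinner (b i) x"
    using assms finite_index by simp
  finally show ?thesis .
qed

text \<open>In coordinate i the eigenvalue equation reads \<open>ev i * c = l * c\<close>. Since
  \<open>ev\<close> may repeat values, degenerate eigenspaces, as occur for the sum operator, are
  covered.\<close>

lemma eigenspace_iff: "x \<in> eigenspace X l \<longleftrightarrow> (\<forall>i\<in>I. ev i = l \<or> cinner (b i) x = 0)"
proof -
  have "x \<in> eigenspace X l \<longleftrightarrow> (\<forall>i\<in>I. cinner (b i) (X *v x) = cinner (b i) (of_real l *s x))"
    unfolding eigenspace_def using vec_eqI by auto
  then show ?thesis
    by (auto simp: cinner_basis_mult cinner_scale_right)
qed

text \<open>A nonzero eigenvector has some nonzero coordinate, and \<open>eigenspace_iff\<close>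
  forces its eigenvalue to be \<open>ev i\<close> there.\<close>

lemma eigenvalues_eq: "eigenvalues X = ev ` I"
proof (intro equalityI subsetI)
  fix l assume "l \<in> eigenvalues X"
  then obtain x where "x \<noteq> 0" "x \<in> eigenspace X l"
    by (auto simp: eigenvalues_def)
  moreover from \<open>x \<noteq> 0\<close> obtain i where "i \<in> I" "cinner (b i) x \<noteq> 0"
    using vec_eqI[of x 0] by auto
  ultimately show "l \<in> ev ` I"
    by (auto simp: eigenspace_iff)
next
  fix l assume "l \<in> ev ` I"
  then obtain i where i: "i \<in> I" "l = ev i"
    by blast
  then have "b i \<noteq> 0"
    using orthonormal[of i i] by auto
  moreover have "b i \<in> eigenspace X l"
    using i eigenvector by (simp add: eigenspace_def)
  ultimately show "l \<in> eigenvalues X"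
    by (auto simp: eigenvalues_def)
qed

lemma orth_proj_eigenspace:
  "orth_proj (eigenspace X l) = diag_op b I (\<lambda>i. if ev i = l then 1 else 0)" (is "_ = ?P")
proof -
  let ?V = "eigenspace X l"
  have P1: "?P *v x \<in> ?V" for x
    by (simp add: eigenspace_iff cinner_basis_diag_op)
  \<comment> \<open>Each Parseval term vanishes: either the coordinate of \<open>y\<close> is zero,
    or \<open>ev i = l\<close> and \<open>?P\<close> keeps that coordinate of
    \<open>x\<close>.\<close>
  have P2: "cinner y (x - ?P *v x) = 0" if "y \<in> ?V" for x y
    using that unfolding parseval[of y]
    by (intro sum.neutral) (auto simp: eigenspace_iff cinner_basis_diag_op cinner_diff_right)
  show ?thesis
    unfolding orth_proj_def
  proof (rule the_equality)
    show "\<forall>x. ?P *v x \<in> ?V \<and> (\<forall>y\<in>?V. cinner y (x - ?P *v x) = 0)"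
      using P1 P2 by blast
  next
    fix Q assume Q: "\<forall>x. Q *v x \<in> ?V \<and> (\<forall>y\<in>?V. cinner y (x - Q *v x) = 0)"
    have "Q *v x = ?P *v x" for x
    proof -
      \<comment> \<open>The difference of two candidate projections lies in the eigenspace and, as a
        difference of two residuals orthogonal to that space, is orthogonal to itself.\<close>
      define d where "d = Q *v x - ?P *v x"
      have "Q *v x \<in> ?V" and "?P *v x \<in> ?V"
        using Q P1 by auto
      then have "d \<in> ?V"
        unfolding d_def eigenspace_iff cinner_diff_right by fastforce
      then have "cinner d (x - ?P *v x) - cinner d (x - Q *v x) = 0"
        using Q P2 by simp
      then have "cinner d d = 0"
        by (simp add: d_def cinner_diff_right)
      then show ?thesis
        by (simp add: cinner_self_eq_0_iff d_def)
    qed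
    then show "Q = ?P"
      by (simp add: matrix_eq)
  qed
qed

text \<open>After swapping the sums, the only eigenvalue contributing to the term of index i is
  \<open>ev i\<close>, so eigenvalues with multiplicity are regrouped correctly.\<close>

lemma fun_calc_eq: "fun_calc g X = diag_op b I (\<lambda>i. g (ev i))"
proof -
  have "fun_calc g X =
      (\<Sum>l\<in>ev ` I. \<Sum>i\<in>I. (if ev i = l then g l else 0) *\<^sub>R ket_bra (b i) (b i))"
    unfolding fun_calc_def eigenvalues_eq orth_proj_eigenspace
    by (auto simp: diag_op_def scaleR_sum_right intro!: sum.cong)
  also have "\<dots> =
      (\<Sum>i\<in>I. (\<Sum>l\<in>ev ` I. if ev i = l then g l else 0) *\<^sub>R ket_bra (b i) (b i))"
    by (subst sum.swap) (simp add: scaleR_sum_left)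
  also have "\<dots> = diag_op b I (\<lambda>i. g (ev i))"
    unfolding diag_op_def using finite_index by (intro sum.cong) auto
  finally show ?thesis .
qed

end

section \<open>Conditional expectation and post-measurement state in the product eigenbasis\<close>

theorem mainTheorem5:
  fixes A :: "complex ^ 'n ^ 'n"
    and N D :: nat
    and a s :: "nat \<Rightarrow> real"
    and ket :: "real \<Rightarrow> complex ^ 'n"
    and \<Psi> :: "complex ^ ('n \<times> 'n)"
    and f e :: "real \<Rightarrow> real"
    and k :: nat
  assumes "N = CARD('n)"
    and "hermitian A"
    and "strict_mono_on {1..N} a"
    and "eigenvalues A = a ` {1..N}"
    and "\<And>n. n \<in> {1..N} \<Longrightarrow> A *v ket (a n) = complex_of_real (a n) *s ket (a n)"
    and "\<And>n m. n \<in> {1..N} \<Longrightarrow> m \<in> {1..N} \<Longrightarrow>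
           cinner (ket (a n)) (ket (a m)) = (if n = m then 1 else 0)"
    and "strict_mono_on {1..D} s"
    and "eigenvalues (op_sum A) = s ` {1..D}"
    and "norm \<Psi> = 1"
    and "quantum_cond_exp \<Psi> (fun_calc f (op1 A)) (op_sum A) e"
    and "k \<in> {1..D}"
    and "sum_prob N a ket \<Psi> (s k) > 0"
  shows "e (s k) = (\<Sum>(n, m)\<in>index_pairs N a (s k).
            f (a n) * (joint_prob ket \<Psi> (a n) (s k - a n) / sum_prob N a ket \<Psi> (s k)))
       \<and> complex_of_real (e (s k)) =
           cinner (post_state N a ket \<Psi> (s k))
             (fun_calc f (op1 A) *v post_state N a ket \<Psi> (s k))
       \<and> expect (post_state N a ket \<Psi> (s k)) (fun_calc f (op1 A)) = complex_of_real (e (s k))"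
proof -
  define I where "I = {1..N} \<times> {1..N}"
  define b where "b i = tensor_vec (ket (a (fst i))) (ket (a (snd i)))" for i
  define q where "q i = (cmod (cinner (b i) \<Psi>))\<^sup>2" for i
  define p where "p = sum_prob N a ket \<Psi> (s k)"
  let ?J = "index_pairs N a (s k)"
  let ?F = "fun_calc f (op1 A)" and ?S = "op_sum A"
  let ?ind = "\<lambda>x. if x = s k then 1 else 0 :: real"
  let ?post = "post_state N a ket \<Psi> (s k)"

  interpret orthonormal_basis b I
  proof
    show "finite I" and "card I = CARD('n \<times> 'n)"
      using assms(1) by (simp_all add: I_def)
    show "cinner (b i) (b j) = (if i = j then 1 else 0)" if "i \<in> I" "j \<in> I" for i j
      using that by (auto simp: I_def b_def cinner_tensor_vec assms(6) split: if_splits)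
  qed
  \<comment> \<open>One basis diagonalises both operators: a product eigenvector has eigenvalue
    \<open>a n\<close> for \<open>op1 A\<close> and \<open>a n + a m\<close> for the sum.\<close>
  interpret A1: eigenbasis b I "op1 A" "\<lambda>i. a (fst i)"
    by unfold_locales
      (auto simp: I_def b_def op1_def tensor_mat_mult_tensor_vec assms(5) tensor_vec_scale_left)
  interpret S: eigenbasis b I ?S "\<lambda>i. a (fst i) + a (snd i)"
    by unfold_locales
      (auto simp: I_def b_def op_sum_def op1_def op2_def matrix_vector_mult_add_rdistrib
        tensor_mat_mult_tensor_vec assms(5) tensor_vec_scale_left tensor_vec_scale_right
        vector_sadd_rdistrib)

  have J: "?J = {i \<in> I. a (fst i) + a (snd i) = s k}"
    by (auto simp: index_pairs_def I_def)
  have sum_J: "(\<Sum>i\<in>I. ?ind (a (fst i) + a (snd i)) * g i) = sum g ?J" for g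
    unfolding J sum.inter_filter[OF finite_index] by (intro sum.cong) auto
  have p: "p = sum q ?J"
    by (simp add: p_def sum_prob_def joint_prob_def q_def b_def split_def)

  have "expect \<Psi> (fun_calc e ?S ** fun_calc ?ind ?S) = expect \<Psi> (?F ** fun_calc ?ind ?S)"
    using assms(10) by (simp add: quantum_cond_exp_def)
  then have "(\<Sum>i\<in>I. e (a (fst i) + a (snd i)) * ?ind (a (fst i) + a (snd i)) * q i)
      = (\<Sum>i\<in>I. f (a (fst i)) * ?ind (a (fst i) + a (snd i)) * q i)"
    unfolding A1.fun_calc_eq S.fun_calc_eq diag_op_mult expect_diag_op q_def of_real_eq_iff .
  then have "(\<Sum>i\<in>?J. e (a (fst i) + a (snd i)) * q i) = (\<Sum>i\<in>?J. f (a (fst i)) * q i)"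
    unfolding sum_J[symmetric] by (simp only: mult_ac)
  \<comment> \<open>On \<open>?J\<close> the argument of \<open>e\<close> is constantly
    \<open>s k\<close>, so the value factors out and leaves the total weight
    \<open>p\<close>.\<close>
  moreover have "(\<Sum>i\<in>?J. e (a (fst i) + a (snd i)) * q i) = e (s k) * p"
    unfolding p sum_distrib_left by (intro sum.cong) (auto simp: J)
  ultimately have e: "e (s k) = (\<Sum>i\<in>?J. f (a (fst i)) * (q i / p))"
    using assms(12) by (simp add: p_def[symmetric] field_simps flip: sum_divide_distrib)

  have "sum_proj N a ket (s k) = diag_op b I (\<lambda>i. ?ind (a (fst i) + a (snd i)))"
    unfolding sum_proj_def diag_op_def J sum.inter_filter[OF finite_index]
    by (intro sum.cong) (auto simp: b_def)
  \<comment> \<open>The projection erases the coordinates outside \<open>?J\<close>; normalisation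
    rescales the others by \<open>1 / sqrt p\<close>.\<close>
  then have "cinner (b i) ?post =
      (1 / sqrt p) *\<^sub>R (?ind (a (fst i) + a (snd i)) * cinner (b i) \<Psi>)" if "i \<in> I" for i
    using that cinner_basis_diag_op[OF that, of "\<lambda>i. ?ind (a (fst i) + a (snd i))" \<Psi>]
    by (simp add: post_state_def cinner_scaleR_right p_def scaleR_conv_of_real[where 'a = complex])
  \<comment> \<open>Squaring leaves the 0/1 indicator unchanged, and positivity of \<open>p\<close>
    turns the squared factor into \<open>1 / p\<close>.\<close>
  then have "(cmod (cinner (b i) ?post))\<^sup>2 = ?ind (a (fst i) + a (snd i)) * (q i / p)"
    if "i \<in> I" for i
    using that assms(12)
    by (simp add: p_def[symmetric] q_def norm_mult power_divide)
  then have "expect ?post ?F =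
      of_real (\<Sum>i\<in>I. f (a (fst i)) * (?ind (a (fst i) + a (snd i)) * (q i / p)))"
    unfolding A1.fun_calc_eq expect_diag_op by (intro arg_cong[where f = of_real] sum.cong) auto
  also have "\<dots> = of_real (e (s k))"
    unfolding e sum_J[symmetric] by (simp only: mult_ac)
  finally have post: "expect ?post ?F = of_real (e (s k))" .

  \<comment> \<open>The constraint defining \<open>?J\<close> allows the second label
    \<open>a m\<close> to be written as \<open>s k - a n\<close>.\<close>
  have "e (s k) = (\<Sum>(n, m)\<in>?J. f (a n) * (joint_prob ket \<Psi> (a n) (s k - a n) / p))"
  proof -
    have "s k - a n = a m" if "(n, m) \<in> ?J" for n m
      using that by (simp add: index_pairs_def)
    then show ?thesis
      unfolding e by (intro sum.cong) (auto simp: joint_prob_def q_def b_def)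
  qed
  then show ?thesis
    using post unfolding p_def expect_eq_cinner by simp
qed

end
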